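(* Let $\mathbb F$ be a field of characteristic $0$ and let $\mathfrak{sl}_2$ be the Lie algebra over $\mathbb F$ with basis $e,f,h$ and brackets $[h,e]=2e$, $[h,f]=-2f$, $[e,f]=h$. Let $b\in\mathbb F$ and $n\in\mathbb Z_{>0}$, and put $\theta:=(t+b-2)(t-b)=t^2-2t-b(b-2)\in\mathbb F[t]$. Let $V_n^{(b)}=\mathbb F[t]^n$ (column vectors $(f_1(t),\dots,f_n(t))^{T}$) with $$h\cdot\begin{pmatrix}f_1(t)\\ \vdots\\ f_n(t)\end{pmatrix}=\begin{pmatrix}tf_1(t)\\ \vdots\\ tf_n(t)\end{pmatrix},\qquad e\cdot\begin{pmatrix}f_1(t)\\ \vdots\\ f_n(t)\end{pmatrix}=-\frac14\begin{pmatrix}\theta f_2(t-2)\\ \theta f_3(t-2)\\ \vdots\\ \theta f_n(t-2)\\ (t-b)f_1(t-2)\end{pmatrix},$$ $$f\cdot\begin{pmatrix}f_1(t)\\ \vdots\\ f_n(t)\end{pmatrix}=\begin{pmatrix}(t+b)f_n(t+2)\\ f_1(t+2)\\ f_2(t+2)\\ \vdots\\ f_{n-1}(t+2)\end{pmatrix}.$$ (For $n=1$ this reads $e\cdot f_1(t)=-\frac14(t-b)f_1(t-2)$ and $f\cdot f_1(t)=(t+b)f_1(t+2)$.) This defines an action of $\mathfrak{sl}_2$ on $V_n^{(b)}$. If $b\notin\mathbb Z_{\le0}$, then $V_n^{(b)}$ is a simple $\mathfrak{sl}_2$-module which is free of rank $n$ when restricted to the subalgebra $\mathbb F[h]=U(\mathfrak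 h)\subseteq U(\mathfrak{sl}_2)$, where $\mathfrak h=\mathbb Fh$; the Casimir element $C=fe+\frac14h(h+2)$ acts on it as the scalar $\chi=\frac14b(b-2)$.
   Context: $U(\mathfrak g)$ denotes the universal enveloping algebra of a Lie algebra $\mathfrak g$; $\mathbb Z_{\le 0}$ is the set of nonpositive integers. *)

theory Defs
  imports
    "HOL-Computational_Algebra.Polynomial"
    "HOL-Library.Poly_Mapping"
    "HOL-Library.Function_Algebras"
    "HOL-Library.FuncSet"
    "HOL-Library.Nonpos_Ints"
begin

section \<open>Lie algebras and their modules\<close>

locale lie_algebra = vector_space scale
  for scale :: "'a::field \<Rightarrow> 'g::ab_group_add \<Rightarrow> 'g" +
  fixes bracket :: "'g \<Rightarrow> 'g \<Rightarrow> 'g"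
  assumes bracket_add_left: "bracket (x + y) z = bracket x z + bracket y z"
    and bracket_add_right: "bracket x (y + z) = bracket x y + bracket x z"
    and bracket_scale_left: "bracket (scale c x) y = scale c (bracket x y)"
    and bracket_scale_right: "bracket x (scale c y) = scale c (bracket x y)"
    and bracket_self: "bracket x x = 0"
    and jacobi: "bracket x (bracket y z) + bracket y (bracket z x) + bracket z (bracket x y) = 0"

text \<open>The underlying space of a module is a subspace \<open>V\<close> of an ambient vector space; the values
  of \<open>act\<close> outside \<open>V\<close> are irrelevant.\<close>

locale lie_module = lie_algebra scale bracket + M: vector_space vscale
  for scale :: "'a::field \<Rightarrow> 'g::ab_group_add \<Rightarrow> 'g"
    and bracket :: "'g \<Rightarrow> 'g \<Rightarrow> 'g"
    and vscale :: "'a \<Rightarrow> 'v::ab_group_add \<Rightarrow> 'v" +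
  fixes V :: "'v set" and act :: "'g \<Rightarrow> 'v \<Rightarrow> 'v"
  assumes subspace_V: "M.subspace V"
    and act_closed: "v \<in> V \<Longrightarrow> act x v \<in> V"
    and act_add_left: "v \<in> V \<Longrightarrow> act (x + y) v = act x v + act y v"
    and act_scale_left: "v \<in> V \<Longrightarrow> act (scale c x) v = vscale c (act x v)"
    and act_add_right: "v \<in> V \<Longrightarrow> w \<in> V \<Longrightarrow> act x (v + w) = act x v + act x w"
    and act_scale_right: "v \<in> V \<Longrightarrow> act x (vscale c v) = vscale c (act x v)"
    and act_bracket: "v \<in> V \<Longrightarrow> act (bracket x y) v = act x (act y v) - act y (act x v)"
begin

definition submodule :: "'v set \<Rightarrow> bool" where
  "submodule W \<longleftrightarrow> M.subspace W \<and> W \<subseteq> V \<and> (\<forall>x. \<forall>w\<in>W. act x w \<in> W)"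

end

locale simple_lie_module = lie_module +
  assumes nonzero: "V \<noteq> {0}"
    and simple: "submodule W \<Longrightarrow> W = {0} \<or> W = V"


section \<open>The universal enveloping algebra\<close>

text \<open>Words form the free monoid on \<open>'g\<close>, so \<open>'g word \<Rightarrow>\<^sub>0 'a\<close> with its convolution product is
  the free associative unital \<open>'a\<close>-algebra on the set \<open>'g\<close>.  (A wrapper around lists is used
  because the type \<open>list\<close> carries no monoid instance.)\<close>

datatype 'g word = Word (letters: "'g list")

instantiation word :: (type) monoid_add
begin
definition zero_word :: "'a word" where "zero_word = Word []"
definition plus_word :: "'a word \<Rightarrow> 'a word \<Rightarrow> 'a word" where
  "plus_word v w = Word (letters v @ letters w)"
instance by standard (auto simp: zero_word_def plus_word_def)
end

definition free_scalar :: "'a::field \<Rightarrow> 'g word \<Rightarrow>\<^sub>0 'a" where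
  "free_scalar c = Poly_Mapping.single 0 c"

definition free_gen :: "'g \<Rightarrow> 'g word \<Rightarrow>\<^sub>0 'a::field" where
  "free_gen x = Poly_Mapping.single (Word [x]) 1"

text \<open>The quotient of the free algebra by the linearity relations \<open>add\<close> and \<open>scale\<close> is the tensor
  algebra of the Lie algebra; adding the relations \<open>bracket\<close> gives the enveloping algebra.\<close>

inductive_set uea_ideal ::
    "('a::field \<Rightarrow> 'g::ab_group_add \<Rightarrow> 'g) \<Rightarrow> ('g \<Rightarrow> 'g \<Rightarrow> 'g) \<Rightarrow> ('g word \<Rightarrow>\<^sub>0 'a) set"
  for scale :: "'a::field \<Rightarrow> 'g::ab_group_add \<Rightarrow> 'g" and bracket :: "'g \<Rightarrow> 'g \<Rightarrow> 'g"
where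
  add: "free_gen (x + y) - free_gen x - free_gen y \<in> uea_ideal scale bracket"
| scale: "free_gen (scale c x) - free_scalar c * free_gen x \<in> uea_ideal scale bracket"
| bracket: "free_gen x * free_gen y - free_gen y * free_gen x - free_gen (bracket x y)
    \<in> uea_ideal scale bracket"
| zero: "0 \<in> uea_ideal scale bracket"
| plus: "p \<in> uea_ideal scale bracket \<Longrightarrow> q \<in> uea_ideal scale bracket
    \<Longrightarrow> p + q \<in> uea_ideal scale bracket"
| mult_left: "p \<in> uea_ideal scale bracket \<Longrightarrow> r * p \<in> uea_ideal scale bracket"
| mult_right: "p \<in> uea_ideal scale bracket \<Longrightarrow> p * r \<in> uea_ideal scale bracket"

definition uea_cong ::
    "('a::field \<Rightarrow> 'g::ab_group_add \<Rightarrow> 'g) \<Rightarrow> ('g \<Rightarrow> 'g \<Rightarrow> 'g)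
      \<Rightarrow> ('g word \<Rightarrow>\<^sub>0 'a) \<Rightarrow> ('g word \<Rightarrow>\<^sub>0 'a) \<Rightarrow> bool" where
  "uea_cong scale bracket p q \<longleftrightarrow> p - q \<in> uea_ideal scale bracket"

lemma uea_ideal_uminus:
  assumes "p \<in> uea_ideal s b" shows "- p \<in> uea_ideal s b"
  using uea_ideal.mult_left[OF assms, of "- 1"] by simp

lemma equivp_uea_cong: "equivp (uea_cong s b)"
proof (rule equivpI)
  show "reflp (uea_cong s b)"
    by (auto simp: reflp_def uea_cong_def uea_ideal.zero)
  show "symp (uea_cong s b)"
    unfolding symp_def uea_cong_def by (metis uea_ideal_uminus minus_diff_eq)
  show "transp (uea_cong s b)"
    unfolding transp_def uea_cong_def
    by (metis uea_ideal.plus diff_add_cancel add_diff_eq)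
qed

lemma uea_cong_add:
  "uea_cong s b p p' \<Longrightarrow> uea_cong s b q q' \<Longrightarrow> uea_cong s b (p + q) (p' + q')"
  unfolding uea_cong_def by (metis uea_ideal.plus add_diff_add)

lemma uea_cong_uminus: "uea_cong s b p p' \<Longrightarrow> uea_cong s b (- p) (- p')"
  unfolding uea_cong_def by (metis uea_ideal_uminus minus_diff_minus)

lemma uea_cong_mult:
  assumes "uea_cong s b p p'" "uea_cong s b q q'"
  shows "uea_cong s b (p * q) (p' * q')"
proof -
  have "p * q - p' * q' = (p - p') * q + p' * (q - q')" by (simp add: algebra_simps)
  then show ?thesis
    using assms unfolding uea_cong_def
    by (metis uea_ideal.plus uea_ideal.mult_left uea_ideal.mult_right)
qed

definition word_act :: "('g \<Rightarrow> 'v \<Rightarrow> 'v) \<Rightarrow> 'g word \<Rightarrow> 'v \<Rightarrow> 'v" where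
  "word_act act w v = foldr act (letters w) v"

definition free_act ::
    "('a::field \<Rightarrow> 'v::ab_group_add \<Rightarrow> 'v) \<Rightarrow> ('g \<Rightarrow> 'v \<Rightarrow> 'v) \<Rightarrow> ('g word \<Rightarrow>\<^sub>0 'a) \<Rightarrow> 'v \<Rightarrow> 'v" where
  "free_act vscale act p v =
    (\<Sum>w\<in>Poly_Mapping.keys p. vscale (Poly_Mapping.lookup p w) (word_act act w v))"

lemma poly_mapping_single_add_induct:
  fixes p :: "'k \<Rightarrow>\<^sub>0 'b::ab_group_add"
  assumes "P 0" and "\<And>k c. P (Poly_Mapping.single k c)"
    and "\<And>p q. P p \<Longrightarrow> P q \<Longrightarrow> P (p + q)"
  shows "P p"
proof (induction "card (Poly_Mapping.keys p)" arbitrary: p rule: less_induct)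
  case less
  show ?case
  proof (cases "p = 0")
    case False
    then obtain k where k: "k \<in> Poly_Mapping.keys p"
      by fastforce
    let ?q = "p - Poly_Mapping.single k (Poly_Mapping.lookup p k)"
    have "Poly_Mapping.keys ?q = Poly_Mapping.keys p - {k}"
      by (auto simp: in_keys_iff lookup_minus lookup_single when_def split: if_splits)
    then have "P ?q"
      by (intro less) (metis card_Diff1_less finite_keys k)
    then have "P (?q + Poly_Mapping.single k (Poly_Mapping.lookup p k))"
      using assms by blast
    then show ?thesis by simp
  qed (use assms in simp)
qed

context lie_module
begin

lemma word_act_closed: "v \<in> V \<Longrightarrow> word_act act w v \<in> V"
proof -
  have "v \<in> V \<Longrightarrow> foldr act xs v \<in> V" for xs
    by (induction xs) (auto simp: act_closed)
  then show "v \<in> V \<Longrightarrow> word_act act w v \<in> V" by (simp add: word_act_def)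
qed

lemma word_act_linear:
  assumes "v \<in> V" "v' \<in> V"
  shows "word_act act w (v + v') = word_act act w v + word_act act w v'"
    and "word_act act w (vscale c v) = vscale c (word_act act w v)"
proof -
  have *: "foldr act xs u \<in> V" if "u \<in> V" for xs u
    using word_act_closed[OF that, of "Word xs"] by (simp add: word_act_def)
  have "foldr act xs (v + v') = foldr act xs v + foldr act xs v'" for xs
    using * assms by (induction xs) (auto simp: act_add_right)
  moreover have "foldr act xs (vscale c v) = vscale c (foldr act xs v)" for xs
    using * assms by (induction xs) (auto simp: act_scale_right)
  ultimately show "word_act act w (v + v') = word_act act w v + word_act act w v'"
    and "word_act act w (vscale c v) = vscale c (word_act act w v)"
    by (simp_all add: word_act_def)
qed

lemma word_act_plus: "word_act act (w + w') v = word_act act w (word_act act w' v)"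
  by (simp add: word_act_def plus_word_def)

abbreviation wact :: "('g word \<Rightarrow>\<^sub>0 'a) \<Rightarrow> 'v \<Rightarrow> 'v" where
  "wact \<equiv> free_act vscale act"

lemma free_act_zero [simp]: "wact 0 v = 0"
  by (simp add: free_act_def)

lemma free_act_superset:
  assumes "finite K" "Poly_Mapping.keys p \<subseteq> K"
  shows "wact p v = (\<Sum>w\<in>K. vscale (Poly_Mapping.lookup p w) (word_act act w v))"
  unfolding free_act_def using assms
  by (intro sum.mono_neutral_left) (auto simp: in_keys_iff)

lemma free_act_single: "wact (Poly_Mapping.single w c) v = vscale c (word_act act w v)"
  using free_act_superset[of "{w}" "Poly_Mapping.single w c" v] by simp

lemma free_act_add: "wact (p + q) v = wact p v + wact q v"
proof -
  let ?K = "Poly_Mapping.keys p \<union> Poly_Mapping.keys q"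
  have "Poly_Mapping.keys (p + q) \<subseteq> ?K" by (rule keys_add)
  then show ?thesis
    by (simp add: free_act_superset[of ?K] lookup_add M.scale_left_distrib sum.distrib)
qed

lemma free_act_diff: "wact (p - q) v = wact p v - wact q v"
  using free_act_add[of "p - q" q v] by (simp add: algebra_simps)

lemma free_act_closed: "v \<in> V \<Longrightarrow> wact p v \<in> V"
  unfolding free_act_def
  by (intro M.subspace_sum M.subspace_scale subspace_V word_act_closed)

lemma free_act_linear:
  assumes "v \<in> V" "v' \<in> V"
  shows "wact p (v + v') = wact p v + wact p v'"
    and "wact p (vscale c v) = vscale c (wact p v)"
  using word_act_linear[OF assms]
  by (simp_all add: free_act_def M.scale_right_distrib sum.distrib M.scale_sum_right mult.commute)

lemma free_act_mult:
  assumes v: "v \<in> V"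
  shows "wact (p * q) v = wact p (wact q v)"
proof (induction p rule: poly_mapping_single_add_induct)
  case (2 w c)
  show ?case
  proof (induction q rule: poly_mapping_single_add_induct)
    case 1
    show ?case using free_act_linear(2)[OF v v, of "Poly_Mapping.single w c" 0] by simp
  next
    case (2 w' c')
    show ?case
      by (simp add: mult_single free_act_single word_act_plus word_act_closed v
          word_act_linear(2)[OF word_act_closed[OF v] word_act_closed[OF v]])
  next
    case (3 p q)
    then show ?case
      by (simp add: distrib_left free_act_add free_act_linear(1) free_act_closed v)
  qed
qed (simp_all add: distrib_right free_act_add)

lemma free_act_gen: "wact (free_gen x) v = act x v"
  by (simp add: free_gen_def free_act_single word_act_def)

lemma free_act_scalar: "wact (free_scalar c) v = vscale c v"
  by (simp add: free_scalar_def free_act_single word_act_def zero_word_def)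

lemma free_act_ideal: "p \<in> uea_ideal scale bracket \<Longrightarrow> v \<in> V \<Longrightarrow> wact p v = 0"
proof (induction arbitrary: v rule: uea_ideal.induct)
  case (mult_left p r)
  then show ?case using free_act_linear(2)[OF mult_left.prems mult_left.prems, of r 0]
    by (simp add: free_act_mult)
qed (simp_all add: free_act_diff free_act_add free_act_mult free_act_gen free_act_scalar
    free_act_closed act_closed act_add_left act_scale_left act_bracket)

lemma free_act_cong:
  "uea_cong scale bracket p q \<Longrightarrow> v \<in> V \<Longrightarrow> wact p v = wact q v"
  using free_act_ideal[of "p - q" v] by (simp add: uea_cong_def free_act_diff)

end


section \<open>The Lie algebra \<open>sl\<^sub>2\<close> and its enveloping algebra\<close>

datatype 'a sl2 = SL2 (e_coeff: 'a) (f_coeff: 'a) (h_coeff: 'a)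

instantiation sl2 :: (ab_group_add) ab_group_add
begin
definition zero_sl2 :: "'a sl2" where "zero_sl2 = SL2 0 0 0"
definition plus_sl2 :: "'a sl2 \<Rightarrow> 'a sl2 \<Rightarrow> 'a sl2" where
  "plus_sl2 x y = SL2 (e_coeff x + e_coeff y) (f_coeff x + f_coeff y) (h_coeff x + h_coeff y)"
definition uminus_sl2 :: "'a sl2 \<Rightarrow> 'a sl2" where
  "uminus_sl2 x = SL2 (- e_coeff x) (- f_coeff x) (- h_coeff x)"
definition minus_sl2 :: "'a sl2 \<Rightarrow> 'a sl2 \<Rightarrow> 'a sl2" where
  "minus_sl2 x y = SL2 (e_coeff x - e_coeff y) (f_coeff x - f_coeff y) (h_coeff x - h_coeff y)"
instance
  by standard
    (auto simp: zero_sl2_def plus_sl2_def uminus_sl2_def minus_sl2_def algebra_simps)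
end

definition sl2_scale :: "'a::field \<Rightarrow> 'a sl2 \<Rightarrow> 'a sl2" where
  "sl2_scale c x = SL2 (c * e_coeff x) (c * f_coeff x) (c * h_coeff x)"

definition e_sl2 :: "'a::field sl2" where "e_sl2 = SL2 1 0 0"
definition f_sl2 :: "'a::field sl2" where "f_sl2 = SL2 0 1 0"
definition h_sl2 :: "'a::field sl2" where "h_sl2 = SL2 0 0 1"

definition sl2_bracket :: "'a::field sl2 \<Rightarrow> 'a sl2 \<Rightarrow> 'a sl2" where
  "sl2_bracket x y = SL2
    (2 * (h_coeff x * e_coeff y - e_coeff x * h_coeff y))
    (- 2 * (h_coeff x * f_coeff y - f_coeff x * h_coeff y))
    (e_coeff x * f_coeff y - f_coeff x * e_coeff y)"

lemmas sl2_defs = zero_sl2_def plus_sl2_def uminus_sl2_def minus_sl2_def sl2_scale_def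
  sl2_bracket_def e_sl2_def f_sl2_def h_sl2_def

interpretation sl2: lie_algebra "sl2_scale :: 'a::field \<Rightarrow> _" sl2_bracket
  by unfold_locales (auto simp: sl2_defs algebra_simps)

lemma sl2_brackets:
  "sl2_bracket h_sl2 e_sl2 = sl2_scale 2 e_sl2"
  "sl2_bracket h_sl2 f_sl2 = sl2_scale (- 2) f_sl2"
  "sl2_bracket e_sl2 f_sl2 = h_sl2"
  by (simp_all add: sl2_defs)

lemma sl2_unique_coordinates:
  "\<exists>!(c, d, k). x = sl2_scale c e_sl2 + sl2_scale d f_sl2 + sl2_scale k h_sl2"
  by (cases x) (auto simp: sl2_defs)

quotient_type (overloaded) 'a uea_sl2 =
  "'a::field sl2 word \<Rightarrow>\<^sub>0 'a" / "uea_cong sl2_scale sl2_bracket"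
  by (rule equivp_uea_cong)

instantiation uea_sl2 :: (field) ring
begin
lift_definition zero_uea_sl2 :: "'a uea_sl2" is 0 .
lift_definition plus_uea_sl2 :: "'a uea_sl2 \<Rightarrow> 'a uea_sl2 \<Rightarrow> 'a uea_sl2" is "(+)"
  by (rule uea_cong_add)
lift_definition uminus_uea_sl2 :: "'a uea_sl2 \<Rightarrow> 'a uea_sl2" is uminus
  by (rule uea_cong_uminus)
lift_definition times_uea_sl2 :: "'a uea_sl2 \<Rightarrow> 'a uea_sl2 \<Rightarrow> 'a uea_sl2" is "(*)"
  by (rule uea_cong_mult)
definition minus_uea_sl2 :: "'a uea_sl2 \<Rightarrow> 'a uea_sl2 \<Rightarrow> 'a uea_sl2" where
  "minus_uea_sl2 u v = u + - v"
instance
  by standard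
    (simp add: minus_uea_sl2_def |
      (transfer, simp add: uea_cong_def algebra_simps uea_ideal.zero))+
end

lemma one_notin_uea_ideal: "1 \<notin> uea_ideal (sl2_scale :: 'a::field \<Rightarrow> _) sl2_bracket"
proof
  interpret lie_module "sl2_scale :: 'a \<Rightarrow> _" sl2_bracket "(*) :: 'a \<Rightarrow> 'a \<Rightarrow> 'a" UNIV "\<lambda>_ _. 0"
    by unfold_locales
      (auto simp: algebra_simps module.subspace_def module_def)
  assume "1 \<in> uea_ideal (sl2_scale :: 'a::field \<Rightarrow> _) sl2_bracket"
  then have "free_act (*) (\<lambda>_ _. 0) (1 :: 'a sl2 word \<Rightarrow>\<^sub>0 'a) (1 :: 'a) = 0"
    by (rule free_act_ideal) simp
  then show False
    using free_act_scalar[of 1 1] by (simp add: free_scalar_def)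
qed

instantiation uea_sl2 :: (field) ring_1
begin
lift_definition one_uea_sl2 :: "'a uea_sl2" is 1 .
instance
proof
  show "(0 :: 'a uea_sl2) \<noteq> 1"
    by transfer (use one_notin_uea_ideal uea_ideal_uminus in \<open>fastforce simp: uea_cong_def\<close>)
qed (transfer, simp add: uea_cong_def uea_ideal.zero)+
end

lift_definition uea_scalar :: "'a::field \<Rightarrow> 'a uea_sl2" is free_scalar .
lift_definition uea_gen :: "'a::field sl2 \<Rightarrow> 'a uea_sl2" is free_gen .

text \<open>On a Lie module the choice of representative is immaterial, and the result is the unique
  \<open>U(sl\<^sub>2)\<close>-module structure extending the given action: see \<open>uea_act_module\<close> below.\<close>

definition uea_act ::
    "('a::field \<Rightarrow> 'v::ab_group_add \<Rightarrow> 'v) \<Rightarrow> ('a sl2 \<Rightarrow> 'v \<Rightarrow> 'v) \<Rightarrow> 'a uea_sl2 \<Rightarrow> 'v \<Rightarrow> 'v" where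
  "uea_act vscale act u v = free_act vscale act (rep_uea_sl2 u) v"

lemma uea_act_abs:
  assumes "lie_module sl2_scale sl2_bracket vscale V act" "v \<in> V"
  shows "uea_act vscale act (abs_uea_sl2 p) v = free_act vscale act p v"
  unfolding uea_act_def using assms lie_module.free_act_cong
  by (metis Quotient_rep_abs[OF Quotient_uea_sl2] equivp_reflp[OF equivp_uea_cong])

lemma uea_act_module:
  assumes M: "lie_module sl2_scale sl2_bracket vscale V act" and v: "v \<in> V" "v' \<in> V"
  shows "uea_act vscale act u v \<in> V"
    and "uea_act vscale act u (v + v') = uea_act vscale act u v + uea_act vscale act u v'"
    and "uea_act vscale act (u + u') v = uea_act vscale act u v + uea_act vscale act u' v"
    and "uea_act vscale act (u * u') v = uea_act vscale act u (uea_act vscale act u' v)"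
    and "uea_act vscale act 1 v = v"
    and "uea_act vscale act (uea_scalar c) v = vscale c v"
    and "uea_act vscale act (uea_gen x) v = act x v"
proof -
  interpret lie_module sl2_scale sl2_bracket vscale V act by (rule M)
  note abs = uea_act_abs[OF M]
  show closed: "uea_act vscale act u v \<in> V" for u
    unfolding uea_act_def using v by (intro free_act_closed)
  show "uea_act vscale act u (v + v') = uea_act vscale act u v + uea_act vscale act u v'"
    unfolding uea_act_def using v by (intro free_act_linear)
  show "uea_act vscale act (u + u') v = uea_act vscale act u v + uea_act vscale act u' v"
    by (induction u rule: uea_sl2.abs_induct; induction u' rule: uea_sl2.abs_induct)
      (simp add: abs v free_act_add plus_uea_sl2.abs_eq)
  show "uea_act vscale act (u * u') v = uea_act vscale act u (uea_act vscale act u' v)"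
    by (induction u rule: uea_sl2.abs_induct; induction u' rule: uea_sl2.abs_induct)
      (simp add: abs v free_act_mult free_act_closed times_uea_sl2.abs_eq)
  show "uea_act vscale act (uea_scalar c) v = vscale c v"
    by (simp add: uea_scalar.abs_eq abs v free_act_scalar)
  show "uea_act vscale act (uea_gen x) v = act x v"
    by (simp add: uea_gen.abs_eq abs v free_act_gen)
  show "uea_act vscale act 1 v = v"
    using free_act_scalar[of 1 v] by (simp add: one_uea_sl2.abs_eq abs v free_scalar_def)
qed

inductive_set subalgebra_gen :: "'a::field uea_sl2 set \<Rightarrow> 'a uea_sl2 set"
  for X :: "'a::field uea_sl2 set"
where
  base: "x \<in> X \<Longrightarrow> x \<in> subalgebra_gen X"
| scalar: "uea_scalar c \<in> subalgebra_gen X"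
| plus: "x \<in> subalgebra_gen X \<Longrightarrow> y \<in> subalgebra_gen X \<Longrightarrow> x + y \<in> subalgebra_gen X"
| mult: "x \<in> subalgebra_gen X \<Longrightarrow> y \<in> subalgebra_gen X \<Longrightarrow> x * y \<in> subalgebra_gen X"

text \<open>The subalgebra \<open>F[h] = U(\<hh>)\<close> of \<open>U(sl\<^sub>2)\<close>, generated by the line \<open>\<hh> = F h\<close>.\<close>

definition uea_h :: "'a::field uea_sl2 set" where
  "uea_h = subalgebra_gen (uea_gen ` range (\<lambda>c. sl2_scale c h_sl2))"

lemma uea_h_eq: "uea_h = subalgebra_gen {uea_gen (h_sl2 :: 'a::field sl2)}"
proof -
  have gen: "uea_gen (sl2_scale c h_sl2) = uea_scalar c * uea_gen (h_sl2 :: 'a sl2)" for c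
    by transfer (simp add: uea_cong_def uea_ideal.scale)
  have "sl2_scale 1 h_sl2 = (h_sl2 :: 'a sl2)" by (simp add: sl2_defs)
  then have h: "uea_gen (h_sl2 :: 'a sl2) \<in> uea_gen ` range (\<lambda>c. sl2_scale c h_sl2)"
    by (metis image_eqI rangeI)
  have cgen: "uea_scalar c * uea_gen h_sl2 \<in> subalgebra_gen {uea_gen (h_sl2 :: 'a sl2)}" for c
    by (intro subalgebra_gen.mult subalgebra_gen.scalar subalgebra_gen.base) simp
  have "x \<in> subalgebra_gen {uea_gen (h_sl2 :: 'a sl2)}" if "x \<in> uea_h" for x
    using that unfolding uea_h_def
    by induction (auto simp: gen cgen intro: subalgebra_gen.scalar subalgebra_gen.plus subalgebra_gen.mult)
  moreover have "x \<in> uea_h" if "x \<in> subalgebra_gen {uea_gen (h_sl2 :: 'a sl2)}" for x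
    using that unfolding uea_h_def
    by induction (use h in \<open>auto intro: subalgebra_gen.intros\<close>)
  ultimately show ?thesis by blast
qed

definition casimir :: "'a::field uea_sl2" where
  "casimir = uea_gen f_sl2 * uea_gen e_sl2
     + uea_scalar (1/4) * (uea_gen h_sl2 * (uea_gen h_sl2 + uea_scalar 2))"

text \<open>A basis of \<open>V\<close> over a subring \<open>A\<close> of a ring acting on \<open>V\<close>: every element has exactly one
  coefficient function, made unique by extensionality outside the basis.\<close>

definition free_of_rank :: "'r set \<Rightarrow> ('r \<Rightarrow> 'v::ab_group_add \<Rightarrow> 'v) \<Rightarrow> 'v set \<Rightarrow> nat \<Rightarrow> bool" where
  "free_of_rank A act V n \<longleftrightarrow>
    (\<exists>B\<subseteq>V. finite B \<and> card B = n \<and>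
      (\<forall>v\<in>V. \<exists>!c. c \<in> B \<rightarrow>\<^sub>E A \<and> v = (\<Sum>x\<in>B. act (c x) x)))"


section \<open>The module \<open>V\<^sub>n\<^sup>(\<^sup>b\<^sup>)\<close>\<close>

text \<open>Column vectors are indexed by \<open>1, \<dots>, n\<close>, as functions vanishing at all other indices.\<close>

definition poly_vecs :: "nat \<Rightarrow> (nat \<Rightarrow> 'a::field poly) set" where
  "poly_vecs n = {v. \<forall>i. i \<notin> {1..n} \<longrightarrow> v i = 0}"

definition vec_scale :: "'a::field \<Rightarrow> (nat \<Rightarrow> 'a poly) \<Rightarrow> nat \<Rightarrow> 'a poly" where
  "vec_scale c v = (\<lambda>i. smult c (v i))"

definition shift :: "'a::field \<Rightarrow> 'a poly \<Rightarrow> 'a poly" where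
  "shift c p = pcompose p [:c, 1:]"

definition tvar :: "'a::field poly" where "tvar = [:0, 1:]"

definition theta :: "'a::field \<Rightarrow> 'a poly" where
  "theta b = (tvar + [:b - 2:]) * (tvar - [:b:])"

lemma theta_expand: "theta b = tvar\<^sup>2 - 2 * tvar - [:b * (b - 2):]"
  by (simp add: theta_def tvar_def power2_eq_square algebra_simps numeral_poly)

definition h_op :: "(nat \<Rightarrow> 'a::field poly) \<Rightarrow> nat \<Rightarrow> 'a poly" where
  "h_op v = (\<lambda>i. tvar * v i)"

definition e_op :: "nat \<Rightarrow> 'a::field \<Rightarrow> (nat \<Rightarrow> 'a poly) \<Rightarrow> nat \<Rightarrow> 'a poly" where
  "e_op n b v = (\<lambda>i.
     if 1 \<le> i \<and> i < n then smult (- (1/4)) (theta b * shift (- 2) (v (i + 1)))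
     else if i = n then smult (- (1/4)) ((tvar - [:b:]) * shift (- 2) (v 1))
     else 0)"

definition f_op :: "nat \<Rightarrow> 'a::field \<Rightarrow> (nat \<Rightarrow> 'a poly) \<Rightarrow> nat \<Rightarrow> 'a poly" where
  "f_op n b v = (\<lambda>i.
     if i = 1 then (tvar + [:b:]) * shift 2 (v n)
     else if 2 \<le> i \<and> i \<le> n then shift 2 (v (i - 1))
     else 0)"

definition V_act :: "nat \<Rightarrow> 'a::field \<Rightarrow> 'a sl2 \<Rightarrow> (nat \<Rightarrow> 'a poly) \<Rightarrow> nat \<Rightarrow> 'a poly" where
  "V_act n b x v = vec_scale (e_coeff x) (e_op n b v) + vec_scale (f_coeff x) (f_op n b v)
     + vec_scale (h_coeff x) (h_op v)"

end

theory Submission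
  imports Defs
begin

text \<open>The vectors \<open>u\<^sub>m = f\<^sup>m \<cdot> (1, 0, \<dots>, 0)\<close>, \<open>m \<ge> 0\<close>, span the module, and
  \<open>h u\<^sub>m = u\<^bsub>m+n\<^esub> - (b + 2m) u\<^sub>m\<close>.  Hence \<open>f\<^sup>n - b - h\<close> has each \<open>u\<^sub>m\<close> as an eigenvector, with the
  pairwise distinct eigenvalues \<open>2m\<close>, and a nonzero submodule contains some \<open>u\<^sub>m\<close>.  Since \<open>e f\<close> is
  multiplication by \<open>-\<theta>/4\<close>, modulo the span of the \<open>u\<^sub>k\<close> with \<open>k > m\<close> the vector \<open>e u\<^bsub>m+1\<^esub>\<close> is
  \<open>-(m + 1)(m + b) u\<^sub>m\<close>, whose coefficient vanishes for no \<open>m\<close> when \<open>b\<close> is not a nonpositive integer.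
  The submodule therefore contains \<open>u\<^sub>0\<close>, hence everything.\<close>

section \<open>Constants and shifts in the polynomial ring\<close>

definition const_poly :: "'a::comm_semiring_0 \<Rightarrow> 'a poly" where
  "const_poly c = [:c:]"

lemma const_poly_simps:
  fixes a c :: "'a::field"
  shows "const_poly (a + c) = const_poly a + const_poly c"
    "const_poly (a - c) = const_poly a - const_poly c"
    "const_poly (- a) = - const_poly a"
    "const_poly (a * c) = const_poly a * const_poly c"
    "const_poly (0 :: 'a) = 0" "const_poly (1 :: 'a) = 1"
    "const_poly (numeral k :: 'a) = numeral k"
    "const_poly (of_nat m :: 'a) = of_nat m"
  by (simp_all add: const_poly_def numeral_poly of_nat_poly one_pCons)

lemma smult_const_poly: "smult c p = const_poly c * p"
  and pCons_const_poly: "[:c:] = const_poly c"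
  by (simp_all add: const_poly_def)

text \<open>Both forms of a scalar, \<open>smult\<close> and \<open>[:c:]\<close>, become
  \<open>const_poly\<close>, which is then pushed through sums and products. Identities over F[t]
  thereby reduce to commutative ring arithmetic, with no polynomial multiplied out
  coefficientwise.\<close>

lemmas poly_ring = smult_const_poly pCons_const_poly const_poly_simps algebra_simps

text \<open>Division is not among the operations that \<open>const_poly_simps\<close> distributes
  over, so the constant 1/4 survives \<open>poly_ring\<close> as an atom; these rules cancel it
  against the numeral 4.\<close>

lemma quarter_cancel: "const_poly (1/4 :: 'a::field_char_0) * (4 * p) = p"
  "const_poly (1/4 :: 'a::field_char_0) * (p * 4) = p"
proof -
  have "const_poly (1/4 :: 'a) * 4 = const_poly (1/4 * 4)"
    by (simp only: const_poly_simps)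
  then have *: "const_poly (1/4 :: 'a) * 4 = 1"
    by (simp add: const_poly_simps)
  then show "const_poly (1/4 :: 'a) * (4 * p) = p" "const_poly (1/4 :: 'a) * (p * 4) = p"
    by (metis mult.assoc mult.commute mult_1)+
qed

lemma shift_ring_hom [simp]:
  "shift c (p + q) = shift c p + shift c q"
  "shift c (p - q) = shift c p - shift c q"
  "shift c (- p) = - shift c p"
  "shift c (p * q) = shift c p * shift c q"
  "shift c 0 = 0" "shift c 1 = 1" "shift c (numeral k) = numeral k"
  by (simp_all add: shift_def pcompose_add pcompose_diff pcompose_uminus pcompose_mult one_pCons
      numeral_poly)

lemma shift_const_poly [simp]: "shift c (const_poly d) = const_poly d"
  by (simp add: shift_def const_poly_def)

lemma shift_tvar [simp]: "shift c tvar = tvar + const_poly c"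
  by (simp add: shift_def tvar_def const_poly_def pcompose_pCons)

lemma shift_shift: "shift c (shift d p) = shift (c + d) p"
  by (simp add: shift_def pcompose_assoc[symmetric] pcompose_pCons add.commute)

lemma shift_zero [simp]: "shift 0 p = p"
  by (simp add: shift_def)

section \<open>The operators e, f, h and their commutation relations\<close>

interpretation vec: vector_space "vec_scale :: 'a::field \<Rightarrow> _"
  by unfold_locales (auto simp: vec_scale_def smult_add_left smult_add_right)

lemma subspace_poly_vecs: "vec.subspace (poly_vecs n)"
  by (auto simp: vec.subspace_def poly_vecs_def vec_scale_def)

lemma subspace_scale_cancel:
  assumes "vec.subspace W" "vec_scale c v \<in> W" "c \<noteq> 0"
  shows "v \<in> W"
proof -
  have "vec_scale (inverse c) (vec_scale c v) \<in> W"
    using assms(1,2) by (rule vec.subspace_scale)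
  then show ?thesis
    using assms(3) by simp
qed

lemma h_op_add [simp]: "h_op (v + w) = h_op v + h_op w"
  and h_op_scale [simp]: "h_op (vec_scale c v) = vec_scale c (h_op v)"
  by (auto simp: h_op_def vec_scale_def poly_ring fun_eq_iff)

lemma e_op_add [simp]: "e_op n b (v + w) = e_op n b v + e_op n b w"
  and e_op_scale [simp]: "e_op n b (vec_scale c v) = vec_scale c (e_op n b v)"
  by (auto simp: e_op_def vec_scale_def poly_ring fun_eq_iff)

lemma f_op_add [simp]: "f_op n b (v + w) = f_op n b v + f_op n b w"
  and f_op_scale [simp]: "f_op n b (vec_scale c v) = vec_scale c (f_op n b v)"
  by (auto simp: f_op_def vec_scale_def poly_ring fun_eq_iff)

lemma op_closed:
  assumes "n > 0" "v \<in> poly_vecs n"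
  shows "h_op v \<in> poly_vecs n" "e_op n b v \<in> poly_vecs n" "f_op n b v \<in> poly_vecs n"
  using assms by (auto simp: poly_vecs_def h_op_def e_op_def f_op_def)

text \<open>For i < n, f moves coordinate i to i+1 and e moves it back, the shifts by 2 and -2
  cancel, and e contributes the factor theta. For i = n the path wraps around through coordinate 1:
  there t+b is shifted to t+b-2, and its product with t-b is again theta.\<close>

lemma e_op_f_op:
  fixes b :: "'a::field_char_0"
  assumes "n > 0" "v \<in> poly_vecs n"
  shows "e_op n b (f_op n b v) = (\<lambda>i. smult (- (1/4)) (theta b * v i))"
proof
  fix i
  show "e_op n b (f_op n b v) i = smult (- (1/4)) (theta b * v i)"
    using assms
    by (auto simp: e_op_def f_op_def poly_vecs_def theta_def shift_shift poly_ring)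
qed

text \<open>Here the factor theta is inserted before f shifts by 2. On the wrap-around path through
  coordinate n the factor is (t+b)(t+2-b), which is also theta(t+2).\<close>

lemma f_op_e_op:
  fixes b :: "'a::field_char_0"
  assumes "n > 0" "v \<in> poly_vecs n"
  shows "f_op n b (e_op n b v) = (\<lambda>i. smult (- (1/4)) (shift 2 (theta b) * v i))"
proof
  fix i
  show "f_op n b (e_op n b v) i = smult (- (1/4)) (shift 2 (theta b) * v i)"
    using assms
    by (auto simp: e_op_def f_op_def poly_vecs_def theta_def shift_shift poly_ring)
qed

text \<open>Both products above carry the factor -1/4, so this difference is what produces [e,f] =
  h.\<close>

lemma theta_shift_diff: "shift 2 (theta b) - theta b = smult 4 (tvar :: 'a::field_char_0 poly)"
  by (simp add: theta_def poly_ring)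

text \<open>Written with a sum on the right, like the two rules after it, so that rewriting moves
  every product towards the order f, e, h.\<close>

lemma e_f_commutator:
  fixes b :: "'a::field_char_0"
  assumes "n > 0" "v \<in> poly_vecs n"
  shows "e_op n b (f_op n b v) = f_op n b (e_op n b v) + h_op v"
proof
  fix i
  have "shift 2 (theta b) * v i = theta b * v i + smult 4 (tvar * v i)"
    using theta_shift_diff[of b] by (metis diff_add_cancel add.commute distrib_right mult_smult_left)
  then show "e_op n b (f_op n b v) i = (f_op n b (e_op n b v) + h_op v) i"
    by (simp add: e_op_f_op[OF assms] f_op_e_op[OF assms] h_op_def smult_diff_right smult_add_right)
qed

lemma h_f_commutator: "h_op (f_op n b v) = f_op n b (h_op v) + vec_scale (- 2) (f_op n b v)"
  by (auto simp: fun_eq_iff h_op_def f_op_def vec_scale_def poly_ring)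

lemma h_e_commutator: "h_op (e_op n b v) = e_op n b (h_op v) + vec_scale 2 (e_op n b v)"
  by (auto simp: fun_eq_iff h_op_def e_op_def vec_scale_def poly_ring)

lemma lie_module_V:
  fixes b :: "'a::field_char_0"
  assumes n: "n > 0"
  shows "lie_module sl2_scale sl2_bracket vec_scale (poly_vecs n) (V_act n b)"
proof unfold_locales
  show "vec.subspace (poly_vecs n)" by (rule subspace_poly_vecs)
next
  fix v :: "nat \<Rightarrow> 'a poly" and x
  assume "v \<in> poly_vecs n"
  then show "V_act n b x v \<in> poly_vecs n"
    unfolding V_act_def
    by (intro vec.subspace_add vec.subspace_scale subspace_poly_vecs op_closed n)
next
  fix v :: "nat \<Rightarrow> 'a poly" and x y
  assume v: "v \<in> poly_vecs n"
  show "V_act n b (sl2_bracket x y) v = V_act n b x (V_act n b y v) - V_act n b y (V_act n b x v)"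
    \<comment> \<open>Once all products are in the order f, e, h, both sides are combinations of the
      same vectors, and only their coefficients remain to be compared.\<close>
    by (rule ext)
       (simp add: V_act_def vec.scale_right_distrib e_f_commutator[OF n v] h_f_commutator
         h_e_commutator sl2_bracket_def,
        simp add: vec_scale_def poly_ring)
next
  fix v :: "nat \<Rightarrow> 'a poly" and x and c :: 'a
  show "V_act n b x (vec_scale c v) = vec_scale c (V_act n b x v)"
    by (simp add: V_act_def vec.scale_right_distrib mult.commute)
qed (auto simp: V_act_def sl2_defs vec_scale_def fun_eq_iff poly_ring)

lemma V_act_basis [simp]:
  "V_act n b e_sl2 = e_op n b" "V_act n b f_sl2 = f_op n b" "V_act n b h_sl2 = h_op"
  by (auto simp: V_act_def sl2_defs vec_scale_def fun_eq_iff)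

section \<open>The Casimir element\<close>

lemma theta_mult_eq_h_op:
  "theta b * v i = (h_op (h_op v) + vec_scale (-2) (h_op v) + vec_scale (- (b * (b - 2))) v) i"
  by (simp add: theta_expand h_op_def vec_scale_def power2_eq_square poly_ring)

text \<open>The product fe acts as -theta(t+2)/4 and theta(t+2) = t^2 + 2t - b(b-2), so adding
  t(t+2)/4 leaves the constant b(b-2)/4.\<close>

lemma casimir_V:
  fixes b :: "'a::field_char_0"
  assumes n: "n > 0" and v: "v \<in> poly_vecs n"
  shows "uea_act vec_scale (V_act n b) casimir v = vec_scale (b * (b - 2) / 4) v"
proof -
  note M = uea_act_module[OF lie_module_V[OF n, of b]]
  have "uea_act vec_scale (V_act n b) casimir v
      = f_op n b (e_op n b v) + vec_scale (1/4) (h_op (h_op v + vec_scale 2 v))"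
    using v unfolding casimir_def
    by (simp add: vec.scale_right_distrib M(2-) M(1)[OF v v] op_closed n vec.subspace_add[OF subspace_poly_vecs]
      vec.subspace_scale[OF subspace_poly_vecs])
  also have "\<dots> = vec_scale (1/4 * (b * (b - 2))) v"
  proof
    fix i
    \<comment> \<open>The name hides the fraction from arithmetic simplification until
      \<open>quarter_cancel\<close> can act on it.\<close>
    define q :: 'a where "q = 1/4"
    have "shift 2 (theta b) * v i = theta b * v i + smult 4 (tvar * v i)"
      using theta_shift_diff[of b] by (metis diff_add_cancel add.commute distrib_right mult_smult_left)
    then show "(f_op n b (e_op n b v) + vec_scale (1/4) (h_op (h_op v + vec_scale 2 v))) i
       = vec_scale (1/4 * (b * (b - 2))) v i"
      unfolding plus_fun_apply f_op_e_op[OF n v] q_def[symmetric]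
      by (simp add: theta_mult_eq_h_op) (simp add: h_op_def vec_scale_def poly_ring quarter_cancel[folded q_def])
  qed
  finally show ?thesis by simp
qed


section \<open>The orbit of the first coordinate vector under f\<close>

definition coord_vec :: "nat \<Rightarrow> 'a::field poly \<Rightarrow> nat \<Rightarrow> 'a poly" where
  "coord_vec i p = (\<lambda>j. if j = i then p else 0)"

lemma coord_vec_in_poly_vecs: "i \<in> {1..n} \<Longrightarrow> coord_vec i p \<in> poly_vecs n"
  by (auto simp: coord_vec_def poly_vecs_def)

lemma sum_coord_vec:
  assumes "finite I"
  shows "(\<Sum>i\<in>I. coord_vec i (p i)) = (\<lambda>j. if j \<in> I then p j else 0)"
  using assms by induction (auto simp: coord_vec_def fun_eq_iff)

lemma poly_vecs_decomp: "v \<in> poly_vecs n \<Longrightarrow> v = (\<Sum>i\<in>{1..n}. coord_vec i (v i))"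
  by (auto simp: sum_coord_vec poly_vecs_def fun_eq_iff)

definition f_orbit :: "nat \<Rightarrow> 'a::field \<Rightarrow> nat \<Rightarrow> nat \<Rightarrow> 'a poly" where
  "f_orbit n b m = (f_op n b ^^ m) (coord_vec 1 1)"

lemma f_op_f_orbit: "f_op n b (f_orbit n b m) = f_orbit n b (Suc m)"
  and f_op_pow_f_orbit: "(f_op n b ^^ k) (f_orbit n b m) = f_orbit n b (k + m)"
  by (simp_all add: f_orbit_def funpow_add)

lemma f_orbit_in_poly_vecs: "n > 0 \<Longrightarrow> f_orbit n b m \<in> poly_vecs n"
  by (induction m) (auto simp: f_op_f_orbit[symmetric] op_closed f_orbit_def coord_vec_in_poly_vecs)

text \<open>Before the entry 1 reaches the last coordinate, f only moves it down; the factor t+b of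
  the wrap-around first enters at m = n.\<close>

lemma f_orbit_eq_coord_vec: "m < n \<Longrightarrow> f_orbit n b m = coord_vec (Suc m) 1"
proof (induction m)
  case 0
  then show ?case by (simp add: f_orbit_def)
next
  case (Suc m)
  then have "f_orbit n b (Suc m) = f_op n b (coord_vec (Suc m) 1)"
    by (simp add: f_op_f_orbit[symmetric])
  then show ?case
    using Suc.prems by (auto simp: f_op_def coord_vec_def fun_eq_iff)
qed

text \<open>For m = 0, n steps of f return to the first coordinate with the factor t+b, so u_n = (h
  + b) u_0. Each further application of f changes the scalar by -2, since [h,f] = -2f.\<close>

lemma h_op_f_orbit:
  fixes b :: "'a::field"
  assumes "n > 0"
  shows "h_op (f_orbit n b m) = f_orbit n b (m + n) - vec_scale (b + 2 * of_nat m) (f_orbit n b m)"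
proof (induction m)
  case 0
  have "f_orbit n b n = f_op n b (coord_vec n 1)"
    using assms f_orbit_eq_coord_vec[of "n - 1" n b] f_op_f_orbit[of n b "n - 1"] by simp
  then show ?case
    using assms
    by (auto simp: f_orbit_def f_op_def coord_vec_def h_op_def vec_scale_def fun_eq_iff poly_ring)
next
  case (Suc m)
  have "h_op (f_orbit n b (Suc m))
      = f_op n b (h_op (f_orbit n b m)) + vec_scale (- 2) (f_orbit n b (Suc m))"
    by (metis h_f_commutator f_op_f_orbit)
  also have "f_op n b (h_op (f_orbit n b m))
      = f_orbit n b (Suc m + n) - vec_scale (b + 2 * of_nat m) (f_orbit n b (Suc m))"
    using f_op_add[of n b "h_op (f_orbit n b m)" "vec_scale (b + 2 * of_nat m) (f_orbit n b m)"]
    by (simp add: Suc f_op_f_orbit algebra_simps del: plus_fun_apply minus_apply)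
  finally show ?case
    by (simp add: vec_scale_def fun_eq_iff poly_ring)
qed

text \<open>The span is stable under h by \<open>h_op_f_orbit\<close>, and its members u_0, ...,
  u_(n-1) are the coordinate vectors, which generate all columns over F[t].\<close>

lemma span_f_orbit:
  fixes b :: "'a::field"
  assumes n: "n > 0"
  shows "vec.span (range (f_orbit n b)) = poly_vecs n"
proof
  let ?S = "vec.span (range (f_orbit n b))"
  show "?S \<subseteq> poly_vecs n"
    by (rule vec.span_minimal) (auto simp: f_orbit_in_poly_vecs n subspace_poly_vecs)
  have h: "h_op v \<in> ?S" if "v \<in> ?S" for v
    using that
  proof (induction rule: vec.span_induct_alt)
    case base
    have "h_op 0 = (0 :: nat \<Rightarrow> 'a poly)" by (simp add: h_op_def fun_eq_iff)
    then show ?case by (simp add: vec.span_zero del: zero_fun_apply)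
  next
    case (step c x y)
    then obtain m where x: "x = f_orbit n b m" by blast
    have "h_op (f_orbit n b m) \<in> ?S"
      unfolding h_op_f_orbit[OF n]
      by (intro vec.span_diff vec.span_scale vec.span_base) simp_all
    then show ?case
      unfolding x h_op_add h_op_scale using step.IH by (intro vec.span_add vec.span_scale)
  qed
  have coord: "coord_vec i p \<in> ?S" if i: "i \<in> {1..n}" for i p
  proof (induction p)
    case 0
    have "coord_vec i 0 = (0 :: nat \<Rightarrow> 'a poly)" by (simp add: coord_vec_def fun_eq_iff)
    then show ?case by (simp add: vec.span_zero del: zero_fun_apply)
  next
    case (pCons a p)
    \<comment> \<open>Horner's rule a + t*p, with h in the role of t, drives the induction on the
      polynomial entry.\<close>
    have decomp: "coord_vec i (pCons a p) = vec_scale a (coord_vec i 1) + h_op (coord_vec i p)"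
      by (auto simp: coord_vec_def vec_scale_def h_op_def tvar_def fun_eq_iff)
    have "f_orbit n b (i - 1) = coord_vec i 1"
      using i by (subst f_orbit_eq_coord_vec) auto
    then have "coord_vec i 1 \<in> ?S"
      by (metis vec.span_base rangeI)
    then show ?case
      unfolding decomp using h[OF pCons.IH] by (simp only: vec.span_add vec.span_scale)
  qed
  show "poly_vecs n \<subseteq> ?S"
  proof
    fix v :: "nat \<Rightarrow> 'a poly" assume "v \<in> poly_vecs n"
    then show "v \<in> ?S"
      by (subst poly_vecs_decomp) (assumption, intro vec.span_sum coord)
  qed
qed

section \<open>Simplicity through eigenvectors and descent\<close>

lemma eigenvector_summands:
  fixes b :: "'a::field_char_0"
  assumes n: "n > 0" and W: "vec.subspace W"
    and h: "\<And>w. w \<in> W \<Longrightarrow> h_op w \<in> W" and f: "\<And>w. w \<in> W \<Longrightarrow> f_op n b w \<in> W"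
    and "finite S" and "(\<Sum>m\<in>S. vec_scale (a m) (f_orbit n b m)) \<in> W" and "m \<in> S"
  shows "vec_scale (a m) (f_orbit n b m) \<in> W"
proof -
  \<comment> \<open>By \<open>h_op_f_orbit\<close> the vector u_(m+n) and the scalar b cancel in D
    u_m, which leaves the eigenvalue 2m. As D is built from f and h, it preserves W.\<close>
  define D where "D v = (f_op n b ^^ n) v - vec_scale b v - h_op v" for v
  have fpow_add: "(f_op n b ^^ k) (v + w) = (f_op n b ^^ k) v + (f_op n b ^^ k) w" for k v w
    by (induction k) (simp_all del: plus_fun_apply)
  have fpow_scale: "(f_op n b ^^ k) (vec_scale c v) = vec_scale c ((f_op n b ^^ k) v)" for k c v
    by (induction k) auto
  have D_add: "D (v + w) = D v + D w" for v w
    by (simp add: D_def fpow_add vec.scale_right_distrib)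
  have D_scale: "D (vec_scale c v) = vec_scale c (D v)" for c v
    by (simp add: D_def fpow_scale vec.scale_right_diff_distrib mult.commute)
  have D_0: "D 0 = 0"
    using D_scale[of 0 0] by simp
  have D_sum: "D (sum g A) = (\<Sum>x\<in>A. D (g x))" for g :: "nat \<Rightarrow> _" and A
    by (induction A rule: infinite_finite_induct) (simp_all add: D_add D_0 del: plus_fun_apply zero_fun_apply)
  have D_orbit: "D (f_orbit n b m) = vec_scale (2 * of_nat m) (f_orbit n b m)" for m
    by (simp add: D_def h_op_f_orbit[OF n] f_op_pow_f_orbit add.commute vec.scale_left_distrib)
  have fpow_W: "(f_op n b ^^ k) w \<in> W" if "w \<in> W" for k w
    using that by (induction k) (auto simp: f)
  have D_W: "D w \<in> W" if "w \<in> W" for w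
    unfolding D_def using that W by (intro vec.subspace_diff vec.subspace_scale fpow_W h)
  show ?thesis
    using assms(5-)
  proof (induction S arbitrary: a m rule: finite_induct)
    case (insert k S)
    let ?x = "\<Sum>m\<in>insert k S. vec_scale (a m) (f_orbit n b m)"
    \<comment> \<open>The operator D - 2k kills summand k and multiplies summand m by 2(m-k), which
      is nonzero for m in S by characteristic 0. The induction hypothesis then applies to S with
      these new coefficients.\<close>
    have "D ?x - vec_scale (2 * of_nat k) ?x
        = (\<Sum>m\<in>insert k S. vec_scale (2 * (of_nat m - of_nat k) * a m) (f_orbit n b m))"
      unfolding D_sum D_scale D_orbit vec.scale_sum_right sum_subtractf[symmetric]
        vec.scale_scale vec.scale_left_diff_distrib[symmetric]
      by (intro sum.cong refl arg_cong2[where f = vec_scale]) (simp add: algebra_simps)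
    also have "\<dots> = (\<Sum>m\<in>S. vec_scale (2 * (of_nat m - of_nat k) * a m) (f_orbit n b m))"
      using insert.hyps by simp
    finally have "D ?x - vec_scale (2 * of_nat k) ?x
        = (\<Sum>m\<in>S. vec_scale (2 * (of_nat m - of_nat k) * a m) (f_orbit n b m))" .
    moreover have "D ?x - vec_scale (2 * of_nat k) ?x \<in> W"
      using insert.prems(1) W by (intro vec.subspace_diff vec.subspace_scale D_W)
    ultimately have IH: "vec_scale (2 * (of_nat m - of_nat k) * a m) (f_orbit n b m) \<in> W"
      if "m \<in> S" for m
      using insert.IH[of "\<lambda>m. 2 * (of_nat m - of_nat k) * a m"] that by simp
    have S: "vec_scale (a m) (f_orbit n b m) \<in> W" if "m \<in> S" for m
    proof -
      have "vec_scale (2 * (of_nat m - of_nat k)) (vec_scale (a m) (f_orbit n b m)) \<in> W"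
        using IH[OF that] by (simp only: vec.scale_scale)
      moreover have "2 * (of_nat m - of_nat k :: 'a) \<noteq> 0"
        using that insert.hyps by auto
      ultimately show ?thesis
        by (rule subspace_scale_cancel[OF W])
    qed
    \<comment> \<open>Summand k, killed before, is recovered by subtracting all the others.\<close>
    have "?x - (\<Sum>m\<in>S. vec_scale (a m) (f_orbit n b m)) \<in> W"
      by (intro vec.subspace_diff[OF W insert.prems(1)] vec.subspace_sum[OF W] S)
    then have "vec_scale (a k) (f_orbit n b k) \<in> W"
      using insert.hyps by simp
    then show ?case using S insert.prems(2) by auto
  qed simp
qed

text \<open>Up to the factor -4, e u_(m+1) is theta u_m. Expanding theta as a polynomial in h gives
  a combination of u_(m+2n), u_(m+n) and u_m, whose first two terms already lie in W.\<close>

lemma f_orbit_descent: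
  fixes b :: "'a::field_char_0"
  assumes n: "n > 0" and b: "b \<notin> \<int>\<^sub>\<le>\<^sub>0" and W: "vec.subspace W"
    and e: "\<And>w. w \<in> W \<Longrightarrow> e_op n b w \<in> W" and f: "\<And>w. w \<in> W \<Longrightarrow> f_op n b w \<in> W"
    and m: "f_orbit n b (Suc m) \<in> W"
  shows "f_orbit n b m \<in> W"
proof -
  let ?u = "f_orbit n b" and ?c = "\<lambda>m. b + 2 * of_nat m"
  have up: "?u (k + Suc m) \<in> W" for k
  proof (induction k)
    case (Suc k)
    then show ?case using f[OF Suc] by (simp add: f_op_f_orbit)
  qed (simp add: m)
  \<comment> \<open>Positivity of n enters here: m+n and m+2n are at least m+1, hence reached from
    u_(m+1) by f.\<close>
  have u1: "?u (m + n) \<in> W" and u2: "?u (m + n + n) \<in> W"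
    using up[of "n - 1"] up[of "n - 1 + n"] n by (simp_all add: add.commute add.left_commute)
  have "e_op n b (?u (Suc m)) \<in> W"
    by (rule e[OF m])
  then have "vec_scale (-4) (e_op n b (f_op n b (?u m))) \<in> W"
    unfolding f_op_f_orbit by (rule vec.subspace_scale[OF W])
  also have "vec_scale (-4) (e_op n b (f_op n b (?u m)))
      = h_op (h_op (?u m)) + vec_scale (-2) (h_op (?u m)) + vec_scale (- (b * (b - 2))) (?u m)"
    by (rule ext, subst theta_mult_eq_h_op[symmetric])
       (simp add: e_op_f_op[OF n f_orbit_in_poly_vecs[OF n]] vec_scale_def)
  also have "h_op (h_op (?u m)) = h_op (?u (m + n)) + vec_scale (- ?c m) (h_op (?u m))"
    using h_op_add[of "h_op (?u m)" "vec_scale (?c m) (?u m)"]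
    by (simp add: h_op_f_orbit[OF n, of b m] algebra_simps)
  also have "h_op (?u (m + n)) + vec_scale (- ?c m) (h_op (?u m)) + vec_scale (-2) (h_op (?u m))
        + vec_scale (- (b * (b - 2))) (?u m)
      = ?u (m + n + n) - vec_scale (?c (m + n) + ?c m + 2) (?u (m + n))
        + vec_scale (4 * (of_nat m + 1) * (b + of_nat m)) (?u m)"
    by (simp add: h_op_f_orbit[OF n] fun_eq_iff vec_scale_def poly_ring)
  finally have "\<dots> - (?u (m + n + n) - vec_scale (?c (m + n) + ?c m + 2) (?u (m + n))) \<in> W"
    using W u1 u2 by (intro vec.subspace_diff vec.subspace_scale)
  then have *: "vec_scale (4 * (of_nat m + 1) * (b + of_nat m)) (?u m) \<in> W"
    by simp
  have "b + of_nat m \<noteq> 0"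
    using b by (metis add_eq_0_iff2 minus_of_nat_in_nonpos_Ints)
  moreover have "(of_nat m + 1 :: 'a) \<noteq> 0"
    using of_nat_neq_0[of m, where 'a = 'a] by (simp add: add.commute)
  ultimately have "4 * (of_nat m + 1) * (b + of_nat m) \<noteq> 0"
    unfolding mult_eq_0_iff by simp
  with * show ?thesis
    by (rule subspace_scale_cancel[OF W])
qed

lemma simple_lie_module_V:
  fixes b :: "'a::field_char_0"
  assumes n: "n > 0" and b: "b \<notin> \<int>\<^sub>\<le>\<^sub>0"
  shows "simple_lie_module sl2_scale sl2_bracket vec_scale (poly_vecs n) (V_act n b)"
proof -
  interpret V: lie_module sl2_scale sl2_bracket vec_scale "poly_vecs n" "V_act n b"
    by (rule lie_module_V[OF n])
  show ?thesis
  proof unfold_locales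
    have "coord_vec 1 1 \<in> poly_vecs n"
      using n by (intro coord_vec_in_poly_vecs) simp
    moreover have "coord_vec 1 1 \<noteq> (0 :: nat \<Rightarrow> 'a poly)"
      by (auto simp: coord_vec_def fun_eq_iff)
    ultimately show "poly_vecs n \<noteq> {0 :: nat \<Rightarrow> 'a poly}" by blast
  next
    fix W assume "V.submodule W"
    then have W: "vec.subspace W" "W \<subseteq> poly_vecs n"
      and act: "\<And>x w. w \<in> W \<Longrightarrow> V_act n b x w \<in> W"
      by (auto simp: V.submodule_def)
    have e: "e_op n b w \<in> W" and f: "f_op n b w \<in> W" and h: "h_op w \<in> W" if "w \<in> W" for w
      using act[OF that, of e_sl2] act[OF that, of f_sl2] act[OF that, of h_sl2] by simp_all
    show "W = {0} \<or> W = poly_vecs n"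
    proof (rule disjCI)
      assume "W \<noteq> poly_vecs n"
      have no_orbit: "f_orbit n b m \<notin> W" for m
      proof
        assume "f_orbit n b m \<in> W"
        then have 0: "f_orbit n b 0 \<in> W"
          by (induction m) (auto intro: f_orbit_descent[OF n b W(1) e f])
        have "f_orbit n b k \<in> W" for k
          by (induction k) (auto simp: 0 f f_op_f_orbit[symmetric])
        then have "vec.span (range (f_orbit n b)) \<subseteq> W"
          by (intro vec.span_minimal W) auto
        with W(2) \<open>W \<noteq> poly_vecs n\<close> show False by (simp add: span_f_orbit[OF n])
      qed
      have "w = 0" if "w \<in> W" for w
      proof -
        have "w \<in> vec.span (range (f_orbit n b))"
          using that W(2) by (auto simp: span_f_orbit[OF n])
        then obtain T r where T: "finite T" "T \<subseteq> range (f_orbit n b)"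
            and w: "w = (\<Sum>x\<in>T. vec_scale (r x) x)"
          unfolding vec.span_explicit by blast
        \<comment> \<open>The span yields a finite set of vectors, whereas the eigenvalues depend on
          the index; an injective choice of indices turns the sum over T into one over m.\<close>
        from T obtain S where S: "finite S" "inj_on (f_orbit n b) S" "T = f_orbit n b ` S"
          by (metis finite_image_iff subset_image_inj)
        have sum: "w = (\<Sum>m\<in>S. vec_scale (r (f_orbit n b m)) (f_orbit n b m))"
          using w S by (simp add: sum.reindex)
        have "r (f_orbit n b m) = 0" if "m \<in> S" for m
        proof (rule ccontr)
          assume "r (f_orbit n b m) \<noteq> 0"
          have "vec_scale (r (f_orbit n b m)) (f_orbit n b m) \<in> W"
            using \<open>w \<in> W\<close> that S(1)
            by (intro eigenvector_summands[OF n W(1) h f, where S = S and a = "\<lambda>m. r (f_orbit n b m)"])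
               (simp_all add: sum[symmetric])
          then have "f_orbit n b m \<in> W"
            using \<open>r (f_orbit n b m) \<noteq> 0\<close> by (rule subspace_scale_cancel[OF W(1)])
          with no_orbit show False by blast
        qed
        then show "w = 0" by (simp add: sum)
      qed
      then show "W = {0}"
        using vec.subspace_0[OF W(1)] by blast
    qed
  qed
qed

section \<open>The subalgebra F[h] as polynomials in h, and freeness over it\<close>

definition uea_of_poly :: "'a::field poly \<Rightarrow> 'a uea_sl2" where
  "uea_of_poly p = fold_coeffs (\<lambda>a u. uea_scalar a + uea_gen h_sl2 * u) p 0"

lemma uea_scalar_simps:
  "uea_scalar 0 = 0" "uea_scalar 1 = 1"
  "uea_scalar (a + c) = uea_scalar a + uea_scalar c"
  "uea_scalar (a * c) = uea_scalar a * uea_scalar c"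
  by (transfer; simp add: free_scalar_def uea_cong_def uea_ideal.zero single_add mult_single)+

text \<open>A scalar sits on the empty word, which is neutral for concatenation on either
  side.\<close>

lemma free_scalar_commute: "free_scalar c * p = p * free_scalar c"
  by (induction p rule: poly_mapping_single_add_induct)
     (simp_all add: free_scalar_def mult_single algebra_simps)

lemma uea_scalar_commute: "uea_scalar c * u = u * uea_scalar c"
  by transfer (simp add: free_scalar_commute uea_cong_def uea_ideal.zero)

lemma uea_of_poly_0 [simp]: "uea_of_poly 0 = 0"
  by (simp add: uea_of_poly_def)

lemma uea_of_poly_pCons [simp]:
  "uea_of_poly (pCons a p) = uea_scalar a + uea_gen h_sl2 * uea_of_poly p"
  \<comment> \<open>The case of \<open>pCons 0 0\<close> is separate: this is the zero polynomial,
    over which \<open>fold_coeffs\<close> performs no step.\<close>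
  by (cases "a = 0 \<and> p = 0") (auto simp: uea_of_poly_def uea_scalar_simps)

lemma uea_of_poly_add: "uea_of_poly (p + q) = uea_of_poly p + uea_of_poly q"
  by (induction p q rule: poly_induct2) (simp_all add: uea_scalar_simps algebra_simps)

lemma uea_of_poly_smult: "uea_of_poly (smult c p) = uea_scalar c * uea_of_poly p"
proof (induction p)
  case (pCons a p)
  have "uea_gen h_sl2 * (uea_scalar c * uea_of_poly p) = uea_scalar c * (uea_gen h_sl2 * uea_of_poly p)"
    by (metis mult.assoc uea_scalar_commute)
  then show ?case
    by (simp add: pCons.IH uea_scalar_simps distrib_left)
qed simp

lemma uea_of_poly_mult: "uea_of_poly (p * q) = uea_of_poly p * uea_of_poly q"
  by (induction p)
     (simp_all add: uea_of_poly_add uea_of_poly_smult uea_scalar_simps distrib_right mult.assoc)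

text \<open>This lets every coefficient from \<open>uea_h\<close> be replaced by a polynomial, whose
  action \<open>uea_act_uea_of_poly\<close> computes.\<close>

lemma uea_h_eq_range: "uea_h = range (uea_of_poly :: 'a::field poly \<Rightarrow> _)"
proof
  show "uea_h \<subseteq> range (uea_of_poly :: 'a poly \<Rightarrow> _)"
  proof
    fix u :: "'a uea_sl2" assume "u \<in> uea_h"
    then show "u \<in> range uea_of_poly"
      unfolding uea_h_eq
    proof induction
      case (base u)
      then have "u = uea_of_poly [:0, 1:]" by (simp add: uea_scalar_simps)
      then show ?case by blast
    next
      case (scalar c)
      have "uea_scalar c = uea_of_poly [:c:]" by simp
      then show ?case by blast
    qed (auto simp: uea_of_poly_add[symmetric] uea_of_poly_mult[symmetric])
  qed
  have "uea_of_poly p \<in> uea_h" for p :: "'a poly"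
  proof (induction p)
    case 0
    show ?case
      using subalgebra_gen.scalar[of 0] by (simp add: uea_h_eq uea_scalar_simps)
  next
    case (pCons a p)
    then show ?case
      unfolding uea_h_eq uea_of_poly_pCons
      by (intro subalgebra_gen.plus subalgebra_gen.scalar subalgebra_gen.mult)
        (auto intro: subalgebra_gen.base)
  qed
  then show "range (uea_of_poly :: 'a poly \<Rightarrow> _) \<subseteq> uea_h" by blast
qed

lemma uea_act_uea_of_poly:
  fixes b :: "'a::field_char_0"
  assumes n: "n > 0" and v: "v \<in> poly_vecs n"
  shows "uea_act vec_scale (V_act n b) (uea_of_poly p) v = (\<lambda>i. p * v i)"
proof (induction p)
  case 0
  note M = uea_act_module[OF lie_module_V[OF n, of b] v v]
  show ?case using M(6)[of 0] by (simp add: uea_scalar_simps fun_eq_iff)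
next
  case (pCons a p)
  note M = uea_act_module[OF lie_module_V[OF n, of b]]
  have "(\<lambda>i. p * v i) \<in> poly_vecs n"
    using v by (auto simp: poly_vecs_def)
  then show ?case
    using v by (simp add: M(3)[OF v v] M(4)[OF v v] M(6)[OF v v] M(7) pCons.IH)
      (simp add: h_op_def vec_scale_def tvar_def fun_eq_iff)
qed

text \<open>The basis consists of the coordinate vectors. Acting by \<open>uea_of_poly p\<close> on
  the i-th one puts p in entry i, so the entries of v both supply the coefficients and determine
  them.\<close>

lemma free_of_rank_V:
  fixes b :: "'a::field_char_0"
  assumes n: "n > 0"
  shows "free_of_rank uea_h (uea_act vec_scale (V_act n b)) (poly_vecs n) n"
  unfolding free_of_rank_def
proof (intro exI conjI ballI)
  let ?e = "\<lambda>i. coord_vec i (1 :: 'a poly)" and ?act = "uea_act vec_scale (V_act n b)"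
  let ?B = "?e ` {1..n}"
  have inj: "inj_on ?e {1..n}"
    by (auto simp: inj_on_def coord_vec_def fun_eq_iff split: if_splits)
  show "?B \<subseteq> poly_vecs n" by (auto intro: coord_vec_in_poly_vecs)
  show "finite ?B" by simp
  show "card ?B = n" using card_image[OF inj] by simp
  have act: "?act (uea_of_poly p) (?e i) = coord_vec i p" if "i \<in> {1..n}" for i p
    unfolding uea_act_uea_of_poly[OF n coord_vec_in_poly_vecs[OF that]]
    by (simp add: coord_vec_def fun_eq_iff)
  have combination: "(\<Sum>x\<in>?B. ?act (c x) x) = (\<lambda>j. if j \<in> {1..n} then p j else 0)"
    if "\<And>i. i \<in> {1..n} \<Longrightarrow> c (?e i) = uea_of_poly (p i)" for c p
  proof -
    have "(\<Sum>x\<in>?B. ?act (c x) x) = (\<Sum>i\<in>{1..n}. coord_vec i (p i))"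
      by (subst sum.reindex[OF inj]) (auto simp: that act intro!: sum.cong)
    then show ?thesis by (simp add: sum_coord_vec)
  qed
  fix v :: "nat \<Rightarrow> 'a poly" assume v: "v \<in> poly_vecs n"
  show "\<exists>!c. c \<in> ?B \<rightarrow>\<^sub>E uea_h \<and> v = (\<Sum>x\<in>?B. ?act (c x) x)"
  proof (rule ex1I)
    \<comment> \<open>\<open>the_inv_into\<close> reads off the index of a basis vector, and
      \<open>restrict\<close> supplies the default value that extensionality demands
      elsewhere.\<close>
    let ?c = "restrict (\<lambda>x. uea_of_poly (v (the_inv_into {1..n} ?e x))) ?B"
    have "?c (?e i) = uea_of_poly (v i)" if "i \<in> {1..n}" for i
      using that the_inv_into_f_f[OF inj that] by simp
    then have "(\<Sum>x\<in>?B. ?act (?c x) x) = v"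
      using v by (subst combination[of _ v]) (auto simp: poly_vecs_def fun_eq_iff)
    then show "?c \<in> ?B \<rightarrow>\<^sub>E uea_h \<and> v = (\<Sum>x\<in>?B. ?act (?c x) x)"
      by (auto simp: uea_h_eq_range)
    fix d assume d: "d \<in> ?B \<rightarrow>\<^sub>E uea_h \<and> v = (\<Sum>x\<in>?B. ?act (d x) x)"
    \<comment> \<open>Any competing coefficient function also comes from polynomials, and comparing
      entries identifies these with the entries of v.\<close>
    have "\<exists>p. d (?e i) = uea_of_poly p" if "i \<in> {1..n}" for i
      using PiE_mem[OF conjunct1[OF d], OF imageI[OF that]] unfolding uea_h_eq_range by blast
    then obtain p where p: "\<And>i. i \<in> {1..n} \<Longrightarrow> d (?e i) = uea_of_poly (p i)"
      by metis
    have "v = (\<lambda>j. if j \<in> {1..n} then p j else 0)"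
      using conjunct2[OF d] combination[of d p, OF p] by (rule trans)
    then have v_eq: "v i = p i" if "i \<in> {1..n}" for i
      using that by simp
    show "d = ?c"
    proof (rule extensionalityI[of d ?B])
      show "d \<in> extensional ?B"
        using d by (simp add: PiE_def)
      fix x assume "x \<in> ?B"
      then obtain i where "x = ?e i" and i: "i \<in> {1..n}" by blast
      then show "d x = ?c x"
        using p[OF i] v_eq[OF i] the_inv_into_f_f[OF inj i] by simp
    qed (rule restrict_extensional)
  qed
qed

theorem mainTheorem7:
  fixes b :: "'a::field_char_0" and n :: nat
  assumes "n > 0"
  shows "lie_module sl2_scale sl2_bracket vec_scale (poly_vecs n) (V_act n b) \<and>
    (b \<notin> \<int>\<^sub>\<le>\<^sub>0 \<longrightarrow>
      simple_lie_module sl2_scale sl2_bracket vec_scale (poly_vecs n) (V_act n b) \<and>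
      free_of_rank uea_h (uea_act vec_scale (V_act n b)) (poly_vecs n) n \<and>
      (\<forall>v\<in>poly_vecs n.
        uea_act vec_scale (V_act n b) casimir v = vec_scale (b * (b - 2) / 4) v))"
  using assms by (simp add: lie_module_V simple_lie_module_V free_of_rank_V casimir_V)

end
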